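(* Suppose that for every $p\in\mathcal{P}$ the following sum-of-squares program is feasible: there exist polynomials $s(\mathbf{x},\mathbf{y})$, $r(\mathbf{x},\mathbf{y})$ and a vector of polynomials $\mathbf{q}(\mathbf{x},\mathbf{y})$ (with $n_u$ entries) such that $$-1-s(\mathbf{x},\mathbf{y})h_p(\mathbf{x})-\mathbf{q}^T(\mathbf{x},\mathbf{y})\boldsymbol{\Lambda}_p^T(\mathbf{x})\mathbf{y}^2-r(\mathbf{x},\mathbf{y})\big(\boldsymbol{\xi}_p^T(\mathbf{x})\mathbf{y}^2+1\big)$$ is SOS and $s(\mathbf{x},\mathbf{y})$ is SOS, where $\mathbf{y}$ is a vector of variables. Then for all $p\in\mathcal{P}$ and all $\mathbf{x}\in\mathcal{X}_p=\{\mathbf{x}\mid h_p(\mathbf{x})\ge0\}$ there exists $\mathbf{u}\in\mathbb{R}^{n_u}$ with $\boldsymbol{\Lambda}_p(\mathbf{x})\mathbf{u}\le\boldsymbol{\xi}_p(\mathbf{x})$.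
   Context: $\mathbf{f}$ and $\mathbf{G}$ are polynomial in $\mathbf{x}\in\mathbb{R}^{n_x}$ (values in $\mathbb{R}^{n_x}$ and $\mathbb{R}^{n_x\times n_u}$), from the control affine system $\dot{\mathbf{x}}=\mathbf{f}(\mathbf{x})+\mathbf{G}(\mathbf{x})\mathbf{u}$ with admissible control set $\mathcal{U}=\{\mathbf{u}\in\mathbb{R}^{n_u}\mid\mathbf{A}\mathbf{u}\le\mathbf{c}\}$, $\mathbf{A}$ and $\mathbf{c}$ a constant matrix and vector, $\mathcal{U}$ compact. $h_1,\dots,h_{N_h}$ are given polynomials, $\mathcal{P}=\{1,\dots,N_h\}$; $\kappa,\epsilon_{cbf},\epsilon_u>0$ are given constants. $L_{\mathbf{f}}h=\frac{\partial h}{\partial\mathbf{x}}\mathbf{f}$, $L_{\mathbf{G}}h=\frac{\partial h}{\partial\mathbf{x}}\mathbf{G}$. For $p\in\mathcal{P}$, $$\boldsymbol{\Lambda}_p(\mathbf{x})=\begin{bmatrix}-L_{\mathbf{G}}h_p(\mathbf{x})\\ \mathbf{A}\end{bmatrix},\qquad\boldsymbol{\xi}_p(\mathbf{x})=\begin{bmatrix}L_{\mathbf{f}}h_p(\mathbf{x})+\kappa h_p(\mathbf{x})-\epsilon_{cbf}\\ \mathbf{c}-\epsilon_u\end{bmatrix},$$ where $\mathbf{c}-\epsilon_u$ subtracts $\epsilon_u$ from every entry. Vector inequalities are elementwise; $\mathbf{y}$ is a real vector of the same length as $\boldsymbol{\xi}_p$ and $\mathbf{y}^2$ is its elementwise square.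 A polynomial is SOS (sum of squares) if it equals $\sum_{i=1}^{N}p_i^2$ for some polynomials $p_1,\dots,p_N$. *)

theory Defs
  imports "HOL-Analysis.Analysis"
begin

text \<open>Real polynomials are represented by the functions they induce
  (\<^const>\<open>real_polynomial_function\<close>, \<^const>\<open>polynomial_function\<close>); since the reals are infinite,
  an identity of such functions is the same as an identity of polynomials.
  A polynomial in two blocks of variables is a polynomial function on the product space.\<close>

definition SOS :: "('a::real_normed_vector \<Rightarrow> real) \<Rightarrow> bool" where
  "SOS P \<longleftrightarrow> (\<exists>(N::nat) p. (\<forall>i<N. real_polynomial_function (p i)) \<and> P = (\<lambda>z. \<Sum>i<N. (p i z)\<^sup>2))"

definition grad :: "(real ^ 'n \<Rightarrow> real) \<Rightarrow> real ^ 'n \<Rightarrow> real ^ 'n" where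
  "grad h x = (\<chi> i. frechet_derivative h (at x) (axis i 1))"

definition lie_f :: "(real ^ 'n \<Rightarrow> real ^ 'n) \<Rightarrow> (real ^ 'n \<Rightarrow> real) \<Rightarrow> real ^ 'n \<Rightarrow> real" where
  "lie_f f h x = grad h x \<bullet> f x"

definition lie_G :: "(real ^ 'n \<Rightarrow> real ^ 'k ^ 'n) \<Rightarrow> (real ^ 'n \<Rightarrow> real) \<Rightarrow> real ^ 'n \<Rightarrow> real ^ 'k" where
  "lie_G G h x = grad h x v* G x"

definition admissible :: "real ^ 'k ^ 'm \<Rightarrow> real ^ 'm \<Rightarrow> (real ^ 'k) set" where
  "admissible A c = {u. A *v u \<le> c}"

text \<open>The stacked objects have one row more than \<open>A\<close>: their rows are indexed by \<open>'m option\<close>,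
  where \<open>None\<close> is the top row and \<open>Some i\<close> is the row coming from row \<open>i\<close> of \<open>A\<close>.\<close>

definition cbf_Lambda ::
  "(real ^ 'n \<Rightarrow> real ^ 'k ^ 'n) \<Rightarrow> real ^ 'k ^ 'm \<Rightarrow> (real ^ 'n \<Rightarrow> real) \<Rightarrow> real ^ 'n
    \<Rightarrow> real ^ 'k ^ ('m option)" where
  "cbf_Lambda G A h x = (\<chi> r. case r of None \<Rightarrow> - lie_G G h x | Some i \<Rightarrow> A $ i)"

definition cbf_xi ::
  "(real ^ 'n \<Rightarrow> real ^ 'n) \<Rightarrow> real ^ 'm \<Rightarrow> real \<Rightarrow> real \<Rightarrow> real \<Rightarrow> (real ^ 'n \<Rightarrow> real) \<Rightarrow> real ^ 'n
    \<Rightarrow> real ^ ('m option)" where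
  "cbf_xi f c \<kappa> \<epsilon>cbf \<epsilon>u h x =
    (\<chi> r. case r of None \<Rightarrow> lie_f f h x + \<kappa> * h x - \<epsilon>cbf | Some i \<Rightarrow> c $ i - \<epsilon>u)"

definition vec_sq :: "real ^ 'n \<Rightarrow> real ^ 'n" where
  "vec_sq y = (\<chi> i. (y $ i)\<^sup>2)"

definition superlevel :: "(real ^ 'n \<Rightarrow> real) \<Rightarrow> (real ^ 'n) set" where
  "superlevel h = {x. h x \<ge> 0}"

end

theory Submission
  imports Defs
begin

text \<open>
  The constraint on the control is a linear system \<open>\<Lambda> u \<le> \<xi>\<close> for each fixed state \<open>x\<close>. By Farkas'
  lemma (\<open>farkas_normalised\<close>), if this system has no solution then there is a certificate \<open>w \<ge> 0\<close>
  with \<open>\<Lambda>\<^sup>T w = 0\<close> and \<open>\<xi>\<^sup>T w = -1\<close>. Every nonnegative vector is an elementwise square, so \<open>w = y\<^sup>2\<close>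
  for some real \<open>y\<close>; this is the role of the squared variables in the program.

  At such a point \<open>(x, y)\<close> the terms multiplied by \<open>q\<close> and \<open>r\<close> vanish, and the polynomial that is
  required to be SOS takes the value \<open>-1 - s h\<close>. With \<open>h \<ge> 0\<close> and \<open>s \<ge> 0\<close> this is at most \<open>-1\<close>, whereas
  an SOS polynomial is nonnegative everywhere. So no certificate exists, and the system is solvable.
  This is the easy direction of the Positivstellensatz, applied to Farkas' alternative.
\<close>

text \<open>The proof separates \<open>b\<close> from the cone generated by \<open>\<plusminus>M e\<close> and \<open>e\<close>, with \<open>e\<close> ranging over the
  standard basis vectors. Every \<open>v\<close> in this cone satisfies \<open>M u \<le> v\<close> for some \<open>u\<close>, so \<open>b\<close> lies outside,
  and strict separation is possible because finitely generated cones are closed. The separating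
  functional \<open>w\<close> is nonnegative on each generator: on \<open>e\<close> this gives \<open>w \<ge> 0\<close>, and on the pair \<open>\<plusminus>M e\<close>
  it gives \<open>M\<^sup>T w = 0\<close>.\<close>

lemma farkas:
  fixes M :: "real ^ 'k ^ 'm" and b :: "real ^ 'm"
  assumes unsolvable: "\<nexists>u. M *v u \<le> b"
  obtains w where "0 \<le> w" "w v* M = 0" "b \<bullet> w < 0"
proof -
  define D where "D = Basis \<union> (*v) M ` Basis \<union> (*v) M ` uminus ` Basis"
  define K where "K = convex_cone hull D"
  define T where "T = {v. \<exists>u. M *v u \<le> v}"
  have "closed K"
    unfolding K_def D_def by (intro closed_convex_cone_hull) simp
  have "convex_cone T"
    unfolding convex_cone_iff
  proof (intro conjI ballI allI impI)
    have "M *v 0 \<le> 0" by simp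
    then show "0 \<in> T" unfolding T_def by blast
  next
    fix v v' assume "v \<in> T" "v' \<in> T"
    then obtain u u' where "M *v u \<le> v" "M *v u' \<le> v'" by (auto simp: T_def)
    then have "M *v (u + u') \<le> v + v'"
      by (simp add: matrix_vector_right_distrib add_mono)
    then show "v + v' \<in> T" unfolding T_def by blast
  next
    fix v and a :: real assume "v \<in> T" "0 \<le> a"
    then obtain u where "M *v u \<le> v" by (auto simp: T_def)
    then have "M *v (a *\<^sub>R u) \<le> a *\<^sub>R v"
      using \<open>0 \<le> a\<close> by (simp add: matrix_vector_mult_scaleR less_eq_vec_def mult_left_mono)
    then show "a *\<^sub>R v \<in> T" unfolding T_def by blast
  qed
  moreover have "D \<subseteq> T"
  proof
    fix v assume "v \<in> D"
    then consider "v \<in> Basis" | u where "v = M *v u" by (auto simp: D_def)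
    then show "v \<in> T"
    proof cases
      case 1
      then have "M *v 0 \<le> v"
        by (auto simp: Basis_vec_def less_eq_vec_def axis_def)
      then show ?thesis unfolding T_def by blast
    qed (auto simp: T_def)
  qed
  ultimately have "K \<subseteq> T"
    unfolding K_def by (intro hull_minimal)
  then have "b \<notin> K" using unsolvable by (auto simp: T_def)
  then obtain w d where w: "w \<bullet> b < d" "\<And>v. v \<in> K \<Longrightarrow> d < w \<bullet> v"
    using separating_hyperplane_closed_point[of K b] \<open>closed K\<close>
    unfolding K_def by (metis convex_convex_cone_hull)
  have "d < 0" using w(2)[of 0] convex_cone_hull_contains_0 by (auto simp: K_def)
  have nonneg: "0 \<le> w \<bullet> v" if "v \<in> D" for v
  proof (rule ccontr)
    assume neg: "\<not> 0 \<le> w \<bullet> v"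
    \<comment> \<open>Scaled so that the functional attains its supposed strict lower bound \<open>d\<close> on \<open>K\<close>.\<close>
    define a where "a = d / (w \<bullet> v)"
    have "0 \<le> a" using neg \<open>d < 0\<close> by (simp add: a_def divide_nonpos_neg)
    then have "a *\<^sub>R v \<in> K"
      using that unfolding K_def by (intro convex_cone_hull_mul hull_inc)
    then show False using w(2)[of "a *\<^sub>R v"] neg by (simp add: a_def)
  qed
  have "0 \<le> w"
    unfolding less_eq_vec_def
  proof
    fix i
    have "axis i 1 \<in> D" by (auto simp: D_def Basis_vec_def)
    then show "0 $ i \<le> w $ i" using nonneg[of "axis i 1"] by (simp add: inner_axis)
  qed
  moreover have "w v* M = 0"
  proof -
    have "(w v* M) \<bullet> e = 0" if "e \<in> Basis" for e
    proof -
      have "0 \<le> w \<bullet> (M *v e)" "0 \<le> w \<bullet> (M *v (- e))"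
        using that by (auto intro!: nonneg simp: D_def)
      moreover have "M *v (- e) = - (M *v e)"
        using matrix_vector_mult_scaleR[of M "-1" e] by simp
      ultimately show ?thesis by (simp add: dot_lmul_matrix)
    qed
    then show ?thesis using euclidean_all_zero_iff by blast
  qed
  moreover have "b \<bullet> w < 0" using w(1) \<open>d < 0\<close> by (simp add: inner_commute)
  ultimately show thesis by (rule that)
qed

corollary farkas_normalised:
  fixes M :: "real ^ 'k ^ 'm" and b :: "real ^ 'm"
  assumes "\<nexists>u. M *v u \<le> b"
  obtains w where "0 \<le> w" "transpose M *v w = 0" "b \<bullet> w = - 1"
proof -
  obtain w where w: "0 \<le> w" "w v* M = 0" "b \<bullet> w < 0"
    using farkas[OF assms] .
  define a where "a = - 1 / (b \<bullet> w)"
  have "0 \<le> a" using w(3) by (simp add: a_def divide_nonpos_neg)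
  show thesis
  proof
    show "0 \<le> a *\<^sub>R w"
      using w(1) \<open>0 \<le> a\<close> by (simp add: less_eq_vec_def)
    show "transpose M *v (a *\<^sub>R w) = 0"
      using w(2) by (simp only: matrix_vector_mult_scaleR transpose_matrix_vector scaleR_zero_right)
    show "b \<bullet> (a *\<^sub>R w) = - 1"
      using w(3) by (simp add: a_def)
  qed
qed

lemma vec_sq_surj_nonneg:
  assumes "0 \<le> w"
  obtains y where "vec_sq y = w"
proof
  show "vec_sq (\<chi> i. sqrt (w $ i)) = w"
    using assms by (simp add: vec_sq_def vec_eq_iff less_eq_vec_def)
qed

lemma SOS_nonneg: "SOS P \<Longrightarrow> 0 \<le> P z"
  by (auto simp: SOS_def intro: sum_nonneg)

theorem theorem5:
  fixes f :: "real ^ 'n \<Rightarrow> real ^ 'n"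
    and G :: "real ^ 'n \<Rightarrow> real ^ 'k ^ 'n"
    and A :: "real ^ 'k ^ 'm"
    and c :: "real ^ 'm"
    and h :: "nat \<Rightarrow> real ^ 'n \<Rightarrow> real"
    and Nh :: nat
    and \<kappa> \<epsilon>cbf \<epsilon>u :: real
  assumes "polynomial_function f"
    and "polynomial_function G"
    and "compact (admissible A c)"
    and "\<forall>p\<in>{1..Nh}. real_polynomial_function (h p)"
    and "\<kappa> > 0" and "\<epsilon>cbf > 0" and "\<epsilon>u > 0"
    and "\<forall>p\<in>{1..Nh}.
      \<exists>(s :: (real ^ 'n) \<times> (real ^ ('m option)) \<Rightarrow> real)
        (r :: (real ^ 'n) \<times> (real ^ ('m option)) \<Rightarrow> real)
        (q :: (real ^ 'n) \<times> (real ^ ('m option)) \<Rightarrow> real ^ 'k).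
        real_polynomial_function s \<and> real_polynomial_function r \<and> polynomial_function q \<and>
        SOS (\<lambda>(x, y). - 1 - s (x, y) * h p x
               - q (x, y) \<bullet> (transpose (cbf_Lambda G A (h p) x) *v vec_sq y)
               - r (x, y) * (cbf_xi f c \<kappa> \<epsilon>cbf \<epsilon>u (h p) x \<bullet> vec_sq y + 1)) \<and>
        SOS s"
  shows "\<forall>p\<in>{1..Nh}. \<forall>x\<in>superlevel (h p).
      \<exists>u :: real ^ 'k. cbf_Lambda G A (h p) x *v u \<le> cbf_xi f c \<kappa> \<epsilon>cbf \<epsilon>u (h p) x"
proof (intro ballI)
  fix p x assume "p \<in> {1..Nh}" and "x \<in> superlevel (h p)"
  then have "0 \<le> h p x" by (simp add: superlevel_def)
  let ?\<Lambda> = "cbf_Lambda G A (h p) x" and ?\<xi> = "cbf_xi f c \<kappa> \<epsilon>cbf \<epsilon>u (h p) x"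
  obtain s r :: "(real ^ 'n) \<times> (real ^ ('m option)) \<Rightarrow> real"
    and q :: "(real ^ 'n) \<times> (real ^ ('m option)) \<Rightarrow> real ^ 'k"
    where sos: "SOS (\<lambda>(x, y). - 1 - s (x, y) * h p x
               - q (x, y) \<bullet> (transpose (cbf_Lambda G A (h p) x) *v vec_sq y)
               - r (x, y) * (cbf_xi f c \<kappa> \<epsilon>cbf \<epsilon>u (h p) x \<bullet> vec_sq y + 1))"
      and "SOS s"
    using assms(8) \<open>p \<in> {1..Nh}\<close> by blast
  show "\<exists>u. ?\<Lambda> *v u \<le> ?\<xi>"
  proof (rule ccontr)
    assume "\<nexists>u. ?\<Lambda> *v u \<le> ?\<xi>"
    then obtain w where w: "0 \<le> w" "transpose ?\<Lambda> *v w = 0" "?\<xi> \<bullet> w = - 1"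
      by (rule farkas_normalised)
    obtain y where "vec_sq y = w" using vec_sq_surj_nonneg[OF w(1)] .
    then have "0 \<le> - 1 - s (x, y) * h p x"
      using SOS_nonneg[OF sos, of "(x, y)"] w(2,3) by (simp del: transpose_matrix_vector)
    moreover have "0 \<le> s (x, y) * h p x"
      using SOS_nonneg[OF \<open>SOS s\<close>] \<open>0 \<le> h p x\<close> by simp
    ultimately show False by simp
  qed
qed

end
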